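(* Let $\Omega$ be a compact Hausdorff space and let $A$ be a C$^*$-algebra. Suppose that every weak-2-local derivation on $A$ is a linear derivation, and that every derivation on $C(\Omega,A)$ is inner. Then every weak-2-local derivation $\Delta: C(\Omega,A)\to C(\Omega,A)$ is a (linear) derivation.
   Context: All C$^*$-algebras are complex. $C(\Omega,A)$ denotes the C$^*$-algebra of all continuous functions $\Omega\to A$ with pointwise operations and the sup norm. A derivation on a C$^*$-algebra $B$ is a linear map $D:B\to B$ with $D(ab)=D(a)b+aD(b)$ for all $a,b\in B$ (such maps are automatically continuous). A derivation $D$ on $B$ is inner if there is $x_0\in B$ with $D(a)=[x_0,a]=x_0a-ax_0$ for all $a\in B$. A weak-2-local derivation on $B$ is a mapping $\Delta:B\to B$ (not assumed linear or continuous) such that for all $a,b\in B$ and every $\phi\in B^*$ there exists a derivation $D_{a,b,\phi}:B\to B$, depending on $a$, $b$ and $\phi$, with $\phi(\Delta(a))=\phi(D_{a,b,\phi}(a))$ and $\phi(\Delta(b))=\phi(D_{a,b,\phi}(b))$. *)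

theory Defs
  imports "HOL-Analysis.Analysis"
begin

section \<open>C*-algebras\<close>

text \<open>
  Complex C*-algebras, not assumed unital or nonzero. The real scalar multiplication of the library
  classes is the restriction of the complex one, and completeness comes from \<^class>\<open>banach\<close>.
\<close>

class scaleC =
  fixes scaleC :: "complex \<Rightarrow> 'a \<Rightarrow> 'a"  (infixr \<open>*\<^sub>C\<close> 75)

class involution =
  fixes star :: "'a \<Rightarrow> 'a"

class cstar_algebra = real_normed_algebra + banach + scaleC + involution +
  assumes scaleC_add_right: "c *\<^sub>C (x + y) = c *\<^sub>C x + c *\<^sub>C y"
    and scaleC_add_left: "(c + d) *\<^sub>C x = c *\<^sub>C x + d *\<^sub>C x"
    and scaleC_scaleC: "c *\<^sub>C d *\<^sub>C x = (c * d) *\<^sub>C x"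
    and scaleC_of_real: "complex_of_real r *\<^sub>C x = r *\<^sub>R x"
    and mult_scaleC_left: "(c *\<^sub>C x) * y = c *\<^sub>C (x * y)"
    and mult_scaleC_right: "x * (c *\<^sub>C y) = c *\<^sub>C (x * y)"
    and norm_scaleC: "norm (c *\<^sub>C x) = cmod c * norm x"
    and star_star: "star (star x) = x"
    and star_add: "star (x + y) = star x + star y"
    and star_scaleC: "star (c *\<^sub>C x) = cnj c *\<^sub>C star x"
    and star_mult: "star (x * y) = star y * star x"
    and cstar_identity: "norm (star x * x) = (norm x)\<^sup>2"

lemma norm_star: "norm (star x) = norm (x :: 'a::cstar_algebra)"
proof -
  have le: "norm y \<le> norm (star y)" for y :: 'a
  proof (cases "norm y = 0")
    case False
    have "norm y * norm y \<le> norm (star y) * norm y"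
      using cstar_identity[of y] norm_mult_ineq[of "star y" y] by (simp add: power2_eq_square)
    then show ?thesis using False by (simp add: mult_le_cancel_right)
  qed auto
  show ?thesis using le[of x] le[of "star x"] by (simp add: star_star)
qed

lemma star_diff: "star (x - y) = star x - star (y :: 'a::cstar_algebra)"
  using star_add[of "x - y" y] by (simp add: algebra_simps)

lemma continuous_on_star:
  fixes f :: "'w::topological_space \<Rightarrow> 'a::cstar_algebra"
  assumes "continuous_on S f"
  shows "continuous_on S (\<lambda>x. star (f x))"
proof -
  have "continuous_on UNIV (star :: 'a \<Rightarrow> 'a)"
    by (auto simp: continuous_on_iff dist_norm norm_star simp flip: star_diff)
  then show ?thesis
    using assms by (rule continuous_on_compose2) auto
qed

lemma continuous_on_scaleC:
  fixes f :: "'w::topological_space \<Rightarrow> 'a::cstar_algebra"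
  assumes "continuous_on S f"
  shows "continuous_on S (\<lambda>x. c *\<^sub>C f x)"
proof -
  have "bounded_linear (\<lambda>x :: 'a. c *\<^sub>C x)"
  proof
    show "c *\<^sub>C (r *\<^sub>R x) = r *\<^sub>R (c *\<^sub>C x)" for r and x :: 'a
      by (simp add: scaleC_scaleC mult.commute flip: scaleC_of_real)
    show "\<exists>K. \<forall>x :: 'a. norm (c *\<^sub>C x) \<le> norm x * K"
      by (rule exI[of _ "cmod c"]) (simp add: norm_scaleC mult.commute)
  qed (simp add: scaleC_add_right)
  then show ?thesis
    using assms by (rule bounded_linear.continuous_on)
qed


section \<open>The C*-algebra of continuous functions\<close>

text \<open>
  For compact \<open>\<Omega>\<close> every continuous function is bounded (see below), so the library type
  \<open>'w \<Rightarrow>\<^sub>C 'a\<close> of bounded continuous functions with the sup norm is \<open>C(\<Omega>, A)\<close>.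
\<close>

lemma apply_bcontfun_Bcontfun_compact:
  fixes f :: "'w::topological_space \<Rightarrow> 'a::metric_space"
  assumes "compact (UNIV :: 'w set)" and "continuous_on UNIV f"
  shows "apply_bcontfun (Bcontfun f) = f"
  using assms by (intro Bcontfun_inverse)
    (auto simp: bcontfun_def intro: compact_imp_bounded compact_continuous_image)

text \<open>
  The library states completeness only for functions on a metric space.
\<close>

instance bcontfun :: (topological_space, complete_space) complete_space
proof
  fix f :: "nat \<Rightarrow> ('a, 'b) bcontfun"
  assume "Cauchy f"
  then obtain g where "uniform_limit UNIV f g sequentially"
    using uniformly_convergent_eq_cauchy[of "\<lambda>_. True" f]
    unfolding Cauchy_def uniform_limit_sequentially_iff
    by (metis dist_fun_lt_imp_dist_val_lt)
  from uniform_limit_bcontfunE[OF this sequentially_bot]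
  obtain l' where "g = apply_bcontfun l'" "(f \<longlonglongrightarrow> l')" by metis
  then show "convergent f"
    by (intro convergentI)
qed

unbundle bcontfun.lifting

instantiation bcontfun :: (topological_space, real_normed_algebra) real_normed_algebra
begin

lift_definition times_bcontfun :: "('a \<Rightarrow>\<^sub>C 'b) \<Rightarrow> ('a \<Rightarrow>\<^sub>C 'b) \<Rightarrow> 'a \<Rightarrow>\<^sub>C 'b"
  is "\<lambda>f g x. f x * g x"
proof -
  fix f g :: "'a \<Rightarrow> 'b"
  assume f: "f \<in> bcontfun" and g: "g \<in> bcontfun"
  then obtain K L where K: "\<And>x. norm (f x) \<le> K" and L: "\<And>x. norm (g x) \<le> L"
    by (auto simp: bcontfun_def bounded_iff)
  show "(\<lambda>x. f x * g x) \<in> bcontfun"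
  proof (rule bcontfun_normI)
    show "continuous_on UNIV (\<lambda>x. f x * g x)"
      using f g by (auto simp: bcontfun_def intro: continuous_on_mult)
    show "norm (f x * g x) \<le> K * L" for x
      using K[of x] L[of x] order_trans[OF norm_ge_zero K[of x]]
      by (intro order_trans[OF norm_mult_ineq] mult_mono) auto
  qed
qed

instance
proof
  fix a :: real and f g h :: "'a \<Rightarrow>\<^sub>C 'b"
  show "f * g * h = f * (g * h)"
    by transfer (simp add: mult.assoc)
  show "(f + g) * h = f * h + g * h"
    by transfer (simp add: distrib_right)
  show "f * (g + h) = f * g + f * h"
    by transfer (simp add: distrib_left)
  show "a *\<^sub>R f * g = a *\<^sub>R (f * g)" and "f * a *\<^sub>R g = a *\<^sub>R (f * g)"
    by (transfer; simp)+
  show "norm (f * g) \<le> norm f * norm g"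
  proof (rule norm_bound)
    fix x
    have "norm (apply_bcontfun f x * apply_bcontfun g x) \<le> norm f * norm g"
      by (intro order_trans[OF norm_mult_ineq] mult_mono norm_bounded) auto
    then show "norm (apply_bcontfun (f * g) x) \<le> norm f * norm g"
      by (simp add: times_bcontfun.rep_eq)
  qed
qed

end

instance bcontfun :: (topological_space, banach) banach ..

instantiation bcontfun :: (topological_space, cstar_algebra) cstar_algebra
begin

lift_definition scaleC_bcontfun :: "complex \<Rightarrow> ('a \<Rightarrow>\<^sub>C 'b) \<Rightarrow> 'a \<Rightarrow>\<^sub>C 'b"
  is "\<lambda>c f x. c *\<^sub>C f x"
proof -
  fix c and f :: "'a \<Rightarrow> 'b"
  assume f: "f \<in> bcontfun"
  then obtain K where K: "\<And>x. norm (f x) \<le> K"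
    by (auto simp: bcontfun_def bounded_iff)
  show "(\<lambda>x. c *\<^sub>C f x) \<in> bcontfun"
  proof (rule bcontfun_normI)
    show "continuous_on UNIV (\<lambda>x. c *\<^sub>C f x)"
      using f by (auto simp: bcontfun_def intro: continuous_on_scaleC)
    show "norm (c *\<^sub>C f x) \<le> cmod c * K" for x
      using K[of x] by (simp add: norm_scaleC mult_left_mono)
  qed
qed

lift_definition star_bcontfun :: "('a \<Rightarrow>\<^sub>C 'b) \<Rightarrow> 'a \<Rightarrow>\<^sub>C 'b"
  is "\<lambda>f x. star (f x)"
  by (auto simp: bcontfun_def bounded_iff norm_star intro: continuous_on_star)

instance
proof
  fix c d :: complex and r :: real and f g :: "'a \<Rightarrow>\<^sub>C 'b"
  show "c *\<^sub>C (f + g) = c *\<^sub>C f + c *\<^sub>C g"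
    by transfer (simp add: scaleC_add_right)
  show "(c + d) *\<^sub>C f = c *\<^sub>C f + d *\<^sub>C f"
    by transfer (simp add: scaleC_add_left)
  show "c *\<^sub>C d *\<^sub>C f = (c * d) *\<^sub>C f"
    by transfer (simp add: scaleC_scaleC)
  show "complex_of_real r *\<^sub>C f = r *\<^sub>R f"
    by transfer (simp add: scaleC_of_real)
  show "(c *\<^sub>C f) * g = c *\<^sub>C (f * g)"
    by transfer (simp add: mult_scaleC_left)
  show "f * (c *\<^sub>C g) = c *\<^sub>C (f * g)"
    by transfer (simp add: mult_scaleC_right)
  show "star (star f) = f"
    by transfer (simp add: star_star)
  show "star (f + g) = star f + star g"
    by transfer (simp add: star_add)
  show "star (c *\<^sub>C f) = cnj c *\<^sub>C star f"
    by transfer (simp add: star_scaleC)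
  show "star (f * g) = star g * star f"
    by transfer (simp add: star_mult)
  show "norm (c *\<^sub>C f) = cmod c * norm f"
  proof (rule antisym)
    show "norm (c *\<^sub>C f) \<le> cmod c * norm f"
      by (rule norm_bound)
        (simp add: scaleC_bcontfun.rep_eq norm_scaleC mult_left_mono norm_bounded)
    show "cmod c * norm f \<le> norm (c *\<^sub>C f)"
    proof (cases "c = 0")
      case False
      have "norm f \<le> norm (c *\<^sub>C f) / cmod c"
      proof (rule norm_bound)
        fix x
        have "cmod c * norm (apply_bcontfun f x) \<le> norm (c *\<^sub>C f)"
          using norm_bounded[of "c *\<^sub>C f" x]
          by (simp add: scaleC_bcontfun.rep_eq norm_scaleC)
        then show "norm (apply_bcontfun f x) \<le> norm (c *\<^sub>C f) / cmod c"
          using False by (simp add: field_simps)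
      qed
      then show ?thesis
        using False by (simp add: field_simps)
    qed simp
  qed
  show "norm (star f * f) = (norm f)\<^sup>2"
  proof (rule antisym)
    have pt: "norm (apply_bcontfun (star f * f) x) = (norm (apply_bcontfun f x))\<^sup>2" for x
      by (simp add: times_bcontfun.rep_eq star_bcontfun.rep_eq cstar_identity)
    show "norm (star f * f) \<le> (norm f)\<^sup>2"
      by (rule norm_bound) (simp add: pt power_mono norm_bounded)
    have "norm f \<le> sqrt (norm (star f * f))"
    proof (rule norm_bound)
      fix x
      have "(norm (apply_bcontfun f x))\<^sup>2 \<le> norm (star f * f)"
        using norm_bounded[of "star f * f" x] by (simp add: pt)
      then show "norm (apply_bcontfun f x) \<le> sqrt (norm (star f * f))"
        by (rule real_le_rsqrt)
    qed
    then show "(norm f)\<^sup>2 \<le> norm (star f * f)"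
      using power_mono[of "norm f" "sqrt (norm (star f * f))" 2] by simp
  qed
qed

end

lifting_update bcontfun.lifting
lifting_forget bcontfun.lifting


section \<open>Derivations and weak-2-local derivations\<close>

definition complex_linear :: "('a::cstar_algebra \<Rightarrow> 'a) \<Rightarrow> bool" where
  "complex_linear D \<longleftrightarrow>
     (\<forall>a b. D (a + b) = D a + D b) \<and> (\<forall>c a. D (c *\<^sub>C a) = c *\<^sub>C D a)"

definition derivation :: "('a::cstar_algebra \<Rightarrow> 'a) \<Rightarrow> bool" where
  "derivation D \<longleftrightarrow> complex_linear D \<and> (\<forall>a b. D (a * b) = D a * b + a * D b)"

definition inner_derivation :: "('a::cstar_algebra \<Rightarrow> 'a) \<Rightarrow> bool" where
  "inner_derivation D \<longleftrightarrow> derivation D \<and> (\<exists>x0. \<forall>a. D a = x0 * a - a * x0)"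

text \<open>The space of bounded complex-linear functionals.\<close>

definition dual :: "('a::cstar_algebra \<Rightarrow> complex) set" where
  "dual = {\<phi>. bounded_linear \<phi> \<and> (\<forall>c a. \<phi> (c *\<^sub>C a) = c * \<phi> a)}"

definition weak_2_local_derivation :: "('a::cstar_algebra \<Rightarrow> 'a) \<Rightarrow> bool" where
  "weak_2_local_derivation \<Delta> \<longleftrightarrow>
     (\<forall>a b. \<forall>\<phi>\<in>dual. \<exists>D. derivation D \<and> \<phi> (\<Delta> a) = \<phi> (D a) \<and> \<phi> (\<Delta> b) = \<phi> (D b))"

end

theory Submission
  imports Defs
begin

text \<open>
  Every derivation of \<open>C(\<Omega>, A)\<close> is a commutator, so its value at \<open>t\<close> depends on \<open>f t\<close> only. Comparing
  \<open>f\<close> with the constant function \<open>f t\<close> through the functionals \<open>f \<mapsto> \<phi> (f t)\<close>, which separate points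
  by the Hahn-Banach theorem, shows that \<open>\<Delta> f t\<close> too depends on \<open>f t\<close> only, and that
  \<open>a \<mapsto> \<Delta> (const a) t\<close> is a weak-2-local derivation of \<open>A\<close>. By hypothesis these maps are derivations,
  and linearity and the Leibniz rule for \<open>\<Delta>\<close> follow pointwise.
\<close>

section \<open>Sublinear functionals and Hahn-Banach\<close>

definition sublinear :: "('v::real_vector \<Rightarrow> real) \<Rightarrow> bool" where
  "sublinear p \<longleftrightarrow> (\<forall>x y. p (x + y) \<le> p x + p y) \<and> (\<forall>r x. 0 \<le> r \<longrightarrow> p (r *\<^sub>R x) = r * p x)"

text \<open>Infima yield homogeneity only as an inequality. Using it for \<open>inverse r\<close> at
  \<open>r *\<^sub>R x\<close> gives the reverse one.\<close>

lemma sublinearI: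
  assumes "\<And>x y. p (x + y) \<le> p x + p y"
    and le: "\<And>r x. 0 < r \<Longrightarrow> p (r *\<^sub>R x) \<le> r * p x"
    and zero: "p 0 = 0"
  shows "sublinear p"
proof -
  have "p (r *\<^sub>R x) = r * p x" if "0 \<le> r" for r x
  proof (cases "r = 0")
    case False
    with that have r: "0 < r" by simp
    have "p x \<le> inverse r * p (r *\<^sub>R x)"
      using le[of "inverse r" "r *\<^sub>R x"] r by simp
    then have "r * p x \<le> p (r *\<^sub>R x)"
      using r by (simp add: field_simps)
    with le[OF r, of x] show ?thesis by simp
  qed (simp add: zero)
  with assms(1) show ?thesis by (simp add: sublinear_def)
qed

lemma sublinear_add: "sublinear p \<Longrightarrow> p (x + y) \<le> p x + p y"
  and sublinear_scaleR: "sublinear p \<Longrightarrow> 0 \<le> r \<Longrightarrow> p (r *\<^sub>R x) = r * p x"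
  by (simp_all add: sublinear_def)

lemma sublinear_zero: "sublinear p \<Longrightarrow> p 0 = 0"
  using sublinear_scaleR[of p 0 0] by simp

lemma sublinear_ge: "sublinear p \<Longrightarrow> - p (- x) \<le> p x"
  using sublinear_add[of p x "- x"] sublinear_zero[of p] by simp

lemma sublinear_norm: "sublinear (norm :: 'v::real_normed_vector \<Rightarrow> real)"
  by (simp add: sublinear_def norm_triangle_ineq)

text \<open>Take the infimum of \<open>p (x + t *\<^sub>R y) - t * p y\<close> over
  \<open>t \<ge> 0\<close>; the values at 0 and 1 give the two bounds. At \<open>- y\<close> the
  second bound reads \<open>q (- y) \<le> - p y\<close>, so any linear functional below
  \<open>q\<close> agrees with \<open>p\<close> at \<open>y\<close>.\<close>

lemma sublinear_lowering:
  assumes p: "sublinear p"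
  obtains q where "sublinear q" "\<And>x. q x \<le> p x" "\<And>x. q x \<le> p (x + y) - p y"
proof -
  define F where "F x t = p (x + t *\<^sub>R y) - t * p y" for x t
  define q where "q x = (INF t\<in>{0..}. F x t)" for x
  have "- p (- x) \<le> F x t" if "0 \<le> t" for x t
    using sublinear_add[OF p, of "x + t *\<^sub>R y" "- x"] sublinear_scaleR[OF p that, of y]
    by (simp add: F_def)
  then have bdd: "bdd_below (F x ` {0..})" for x
    by (intro bdd_belowI2[of _ "- p (- x)"]) auto
  have q_le: "q x \<le> F x t" if "0 \<le> t" for x t
    using that bdd unfolding q_def by (auto intro: cINF_lower)
  have le_q: "c \<le> q x" if "\<And>t. 0 \<le> t \<Longrightarrow> c \<le> F x t" for c x
    using that unfolding q_def by (auto intro: cINF_greatest)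
  have "sublinear q"
  proof (rule sublinearI)
    fix x z
    have *: "q (x + z) \<le> F x s + F z t" if "0 \<le> s" "0 \<le> t" for s t
    proof -
      have "F (x + z) (s + t) \<le> F x s + F z t"
        using sublinear_add[OF p, of "x + s *\<^sub>R y" "z + t *\<^sub>R y"]
        by (simp add: F_def algebra_simps)
      then show ?thesis using q_le[of "s + t" "x + z"] that by simp
    qed
    \<comment> \<open>The double infimum is taken one variable at a time: first over
      \<open>t\<close> with \<open>s\<close> fixed, then over \<open>s\<close>.\<close>
    have "q (x + z) - F x s \<le> q z" if "0 \<le> s" for s
      using *[OF that] by (intro le_q) (simp add: algebra_simps)
    then have "q (x + z) - q z \<le> q x"
      by (intro le_q) (simp add: algebra_simps)
    then show "q (x + z) \<le> q x + q z" by simp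
  next
    fix r :: real and x
    assume r: "0 < r"
    have "q (r *\<^sub>R x) / r \<le> F x t" if "0 \<le> t" for t
    proof -
      \<comment> \<open>Rescaling the parameter along with the argument turns \<open>F\<close> into
        a homogeneous expression.\<close>
      have "F (r *\<^sub>R x) (r * t) = r * F x t"
        using sublinear_scaleR[OF p, of r "x + t *\<^sub>R y"] r by (simp add: F_def algebra_simps)
      then show ?thesis
        using q_le[of "r * t" "r *\<^sub>R x"] that r by (simp add: field_simps)
    qed
    then have "q (r *\<^sub>R x) / r \<le> q x" by (rule le_q)
    then show "q (r *\<^sub>R x) \<le> r * q x" using r by (simp add: field_simps)
  next
    show "q 0 = 0"
    proof (rule antisym)
      show "q 0 \<le> 0" using q_le[of 0 0] by (simp add: F_def sublinear_zero[OF p])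
      show "0 \<le> q 0" by (rule le_q) (simp add: F_def sublinear_scaleR[OF p])
    qed
  qed
  moreover have "q x \<le> p x" "q x \<le> p (x + y) - p y" for x
    using q_le[of 0 x] q_le[of 1 x] by (simp_all add: F_def)
  ultimately show thesis using that by blast
qed

text \<open>The pointwise infimum works: the common bound \<open>p0\<close> keeps it finite, since
  every member is at least \<open>- p0 (- x)\<close> at \<open>x\<close>.\<close>

lemma sublinear_Inf_chain:
  assumes C: "\<And>p. p \<in> C \<Longrightarrow> sublinear p" "\<And>p. p \<in> C \<Longrightarrow> p \<le> p0" "C \<noteq> {}"
    and chain: "\<And>p q. p \<in> C \<Longrightarrow> q \<in> C \<Longrightarrow> p \<le> q \<or> q \<le> p"
  obtains u where "sublinear u" "\<And>p. p \<in> C \<Longrightarrow> u \<le> p"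
proof -
  define u where "u x = (INF p\<in>C. p x)" for x
  have "- p0 (- x) \<le> p x" if "p \<in> C" for p x
    using sublinear_ge[OF C(1)[OF that], of x] le_funD[OF C(2)[OF that], of "- x"] by simp
  then have bdd: "bdd_below ((\<lambda>p. p x) ` C)" for x
    by (intro bdd_belowI2[of _ "- p0 (- x)"]) auto
  have u_le: "u x \<le> p x" if "p \<in> C" for p x
    using that bdd unfolding u_def by (auto intro: cINF_lower)
  have le_u: "c \<le> u x" if "\<And>p. p \<in> C \<Longrightarrow> c \<le> p x" for c x
    using that C(3) unfolding u_def by (auto intro: cINF_greatest)
  have "sublinear u"
  proof (rule sublinearI)
    fix x y
    have *: "u (x + y) \<le> p x + q y" if "p \<in> C" "q \<in> C" for p q
    proof -
      \<comment> \<open>The smaller of \<open>p\<close> and \<open>q\<close> bounds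
        \<open>u (x + y)\<close> by \<open>r x + r y\<close>, hence by \<open>p x + q y\<close>;
        this is where the chain property enters.\<close>
      obtain r where r: "r \<in> C" "r \<le> p" "r \<le> q"
        using chain[OF \<open>p \<in> C\<close> \<open>q \<in> C\<close>] \<open>p \<in> C\<close> \<open>q \<in> C\<close> by blast
      show ?thesis
        using u_le[OF r(1), of "x + y"] sublinear_add[OF C(1)[OF r(1)], of x y]
          le_funD[OF r(2), of x] le_funD[OF r(3), of y] by simp
    qed
    have "u (x + y) - p x \<le> u y" if "p \<in> C" for p
      using *[OF that] by (intro le_u) (simp add: algebra_simps)
    then have "u (x + y) - u y \<le> u x"
      by (intro le_u) (simp add: algebra_simps)
    then show "u (x + y) \<le> u x + u y" by simp
  next
    fix r :: real and x
    assume r: "0 < r"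
    have "u (r *\<^sub>R x) / r \<le> p x" if "p \<in> C" for p
      using u_le[OF that, of "r *\<^sub>R x"] sublinear_scaleR[OF C(1)[OF that], of r x] r
      by (simp add: field_simps)
    then have "u (r *\<^sub>R x) / r \<le> u x" by (rule le_u)
    then show "u (r *\<^sub>R x) \<le> r * u x" using r by (simp add: field_simps)
  next
    show "u 0 = 0"
      using C(3) by (simp add: u_def sublinear_zero[OF C(1)])
  qed
  then show thesis using u_le that by (auto simp: le_fun_def)
qed

text \<open>Lowering \<open>p\<close> in the direction \<open>y\<close> cannot change it, so the
  second bound of the lowering becomes superadditivity.\<close>

lemma linear_if_minimal_sublinear:
  assumes p: "sublinear p" and min: "\<And>q. sublinear q \<Longrightarrow> q \<le> p \<Longrightarrow> q = p"
  shows "linear p"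
proof -
  have add: "p (x + y) = p x + p y" for x y
  proof -
    obtain q where q: "sublinear q" "\<And>x. q x \<le> p x" "\<And>x. q x \<le> p (x + y) - p y"
      using sublinear_lowering[OF p] by blast
    then have "q = p" by (intro min) (auto simp: le_fun_def)
    then show ?thesis using q(3)[of x] sublinear_add[OF p, of x y] by simp
  qed
  have minus: "p (- x) = - p x" for x
    using add[of x "- x"] sublinear_zero[OF p] by simp
  have "p (r *\<^sub>R x) = r * p x" for r x
  proof (cases "0 \<le> r")
    case False
    then show ?thesis
      using sublinear_scaleR[OF p, of "- r" x] minus[of "r *\<^sub>R x"] by simp
  qed (rule sublinear_scaleR[OF p])
  with add show ?thesis by (intro linearI) auto
qed

lemma linear_below_sublinear:
  assumes p0: "sublinear p0"
  obtains f where "linear f" "\<And>x. f x \<le> p0 x"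
proof -
  define A where "A = {p. sublinear p \<and> p \<le> p0}"
  \<comment> \<open>The order is reversed, so that the maximal element from Zorn's lemma is a
    minimal sublinear functional.\<close>
  let ?R = "relation_of (\<lambda>p q. q \<le> p) A"
  have "partial_order_on A ?R"
    by (rule partial_order_on_relation_ofI) auto
  moreover have "\<exists>u\<in>A. \<forall>p\<in>C. u \<le> p" if "C \<in> Chains ?R" for C
  proof (cases "C = {}")
    case True
    with p0 show ?thesis by (auto simp: A_def)
  next
    case False
    have C: "p \<in> A" if "p \<in> C" for p
      using that \<open>C \<in> Chains ?R\<close> by (auto simp: Chains_def relation_of_def)
    have chain: "p \<le> q \<or> q \<le> p" if "p \<in> C" "q \<in> C" for p q
      using that \<open>C \<in> Chains ?R\<close> by (auto simp: Chains_def relation_of_def)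
    obtain u where u: "sublinear u" "\<And>p. p \<in> C \<Longrightarrow> u \<le> p"
      using sublinear_Inf_chain[of C p0] C chain False unfolding A_def by blast
    obtain p where "p \<in> C" using False by blast
    then have "u \<in> A"
      using u C[of p] by (auto simp: A_def intro: order_trans)
    with u show ?thesis by blast
  qed
  ultimately obtain f where f: "f \<in> A" and min: "\<And>q. q \<in> A \<Longrightarrow> q \<le> f \<Longrightarrow> q = f"
    using predicate_Zorn[of A "\<lambda>p q. q \<le> p"] by blast
  have "linear f"
    using f min by (intro linear_if_minimal_sublinear) (auto simp: A_def intro: order_trans)
  with f show thesis using that by (auto simp: A_def le_fun_def)
qed

text \<open>Lowering the norm in the direction \<open>x\<close> first replaces extension from the
  line through \<open>x\<close>: a linear \<open>f\<close> below \<open>q\<close> has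
  \<open>f (- x) \<le> - norm x\<close>.\<close>

lemma norming_functional:
  fixes x :: "'v::real_normed_vector"
  obtains f where "bounded_linear f" "f x = norm x" "\<And>y. \<bar>f y\<bar> \<le> norm y"
proof -
  obtain q where q: "sublinear q" "\<And>y. q y \<le> norm y" "\<And>y. q y \<le> norm (y + x) - norm x"
    using sublinear_lowering[OF sublinear_norm] by blast
  obtain f where f: "linear f" "\<And>y. f y \<le> q y"
    using linear_below_sublinear[OF q(1)] by blast
  have le: "f y \<le> norm y" for y
    using f(2)[of y] q(2)[of y] by simp
  have abs: "\<bar>f y\<bar> \<le> norm y" for y
    using le[of y] le[of "- y"] linear_neg[OF f(1), of y] by simp
  have "norm x \<le> f x"
    using f(2)[of "- x"] q(3)[of "- x"] linear_neg[OF f(1), of x] by simp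
  with le[of x] have "f x = norm x" by simp
  moreover have "bounded_linear f"
    by (rule bounded_linear_intro[of f 1])
      (simp_all add: linear_add[OF f(1)] linear_scale[OF f(1)] abs)
  ultimately show thesis using that abs by blast
qed

section \<open>Separation of points by the complex dual\<close>

lemma bounded_linear_scaleC: "bounded_linear (\<lambda>x :: 'a::cstar_algebra. c *\<^sub>C x)"
proof (rule bounded_linear_intro)
  show "c *\<^sub>C (r *\<^sub>R x) = r *\<^sub>R (c *\<^sub>C x)" for r and x :: 'a
    by (simp add: scaleC_scaleC mult.commute flip: scaleC_of_real)
  show "norm (c *\<^sub>C x) \<le> norm x * cmod c" for x :: 'a
    by (simp add: norm_scaleC mult.commute)
qed (simp add: scaleC_add_right)

text \<open>A real functional \<open>f\<close> is the real part of the complex functional \<open>x \<mapsto> f x - \<i> f (\<i> x)\<close>.\<close>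

lemma dual_separates:
  fixes x :: "'a::cstar_algebra"
  assumes "\<And>\<phi>. \<phi> \<in> dual \<Longrightarrow> \<phi> x = 0"
  shows "x = 0"
proof -
  obtain f :: "'a \<Rightarrow> real" where f: "bounded_linear f" "f x = norm x"
    using norming_functional by blast
  interpret f: bounded_linear f by fact
  define \<phi> where "\<phi> y = complex_of_real (f y) - \<i> * complex_of_real (f (\<i> *\<^sub>C y))" for y
  have "bounded_linear \<phi>"
    unfolding \<phi>_def
    by (intro bounded_linear_sub bounded_linear_compose[OF bounded_linear_of_real]
        bounded_linear_compose[OF bounded_linear_mult_right] f
        bounded_linear_compose[OF f(1) bounded_linear_scaleC])
  moreover have "\<phi> (c *\<^sub>C y) = c * \<phi> y" for c y
  proof -
    \<comment> \<open>Since \<open>f\<close> is only real linear, \<open>d\<close> is split into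
      real and imaginary parts. The cases \<open>c\<close> and \<open>\<i> * c\<close> give the two
      parts of \<open>\<phi> (c *\<^sub>C y)\<close>.\<close>
    have split: "f (d *\<^sub>C y) = Re d * f y + Im d * f (\<i> *\<^sub>C y)" for d
    proof -
      have "d *\<^sub>C y = (complex_of_real (Re d) + complex_of_real (Im d) * \<i>) *\<^sub>C y"
        by (rule arg_cong[of _ _ "\<lambda>c. c *\<^sub>C y"]) (simp add: complex_eq_iff)
      also have "\<dots> = Re d *\<^sub>R y + Im d *\<^sub>R (\<i> *\<^sub>C y)"
        by (simp only: scaleC_add_left scaleC_of_real flip: scaleC_scaleC)
      finally show ?thesis by (simp add: f.add f.scale)
    qed
    show ?thesis
      using split[of c] split[of "\<i> * c"]
      by (simp add: \<phi>_def scaleC_scaleC complex_eq_iff algebra_simps)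
  qed
  ultimately have "\<phi> \<in> dual" by (simp add: dual_def)
  from assms[OF this] have "Re (\<phi> x) = 0" by simp
  then show ?thesis using f(2) by (simp add: \<phi>_def)
qed

lemma dual_eqI:
  fixes x y :: "'a::cstar_algebra"
  assumes "\<And>\<phi>. \<phi> \<in> dual \<Longrightarrow> \<phi> x = \<phi> y"
  shows "x = y"
proof -
  have "\<phi> (x - y) = 0" if "\<phi> \<in> dual" for \<phi>
  proof -
    have "bounded_linear \<phi>" using that by (simp add: dual_def)
    from linear_diff[OF bounded_linear.linear[OF this]] show ?thesis
      using assms[OF that] by simp
  qed
  then have "x - y = 0" by (rule dual_separates)
  then show ?thesis by simp
qed

section \<open>Evaluation at points and the induced maps on the coefficient algebra\<close>

lemma dual_comp_eval:
  fixes \<phi> :: "'a::cstar_algebra \<Rightarrow> complex"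
  assumes "\<phi> \<in> dual"
  shows "(\<lambda>f :: 'w::topological_space \<Rightarrow>\<^sub>C 'a. \<phi> (apply_bcontfun f t)) \<in> dual"
proof -
  have "bounded_linear (\<lambda>f :: 'w \<Rightarrow>\<^sub>C 'a. apply_bcontfun f t)"
    by (rule bounded_linear_intro[of _ 1])
      (simp_all add: norm_bounded)
  with assms show ?thesis
    by (auto simp: dual_def scaleC_bcontfun.rep_eq intro: bounded_linear_compose)
qed

lemma derivation_commutator:
  "derivation (\<lambda>a. x * a - a * x)" for x :: "'a::cstar_algebra"
proof -
  have "c *\<^sub>C (a - b) = c *\<^sub>C a - c *\<^sub>C b" for c and a b :: 'a
    using bounded_linear_scaleC by (rule linear_diff[OF bounded_linear.linear])
  then show ?thesis
    by (simp add: derivation_def complex_linear_def mult_scaleC_left mult_scaleC_right algebra_simps)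
qed

text \<open>Test \<open>\<Delta>\<close> against \<open>\<phi>\<close> composed with evaluation at
  \<open>t\<close>. The resulting derivation is the commutator with some \<open>x0\<close>, and
  since products are pointwise, \<open>y\<close> is the value of \<open>x0\<close> at
  \<open>t\<close>. One \<open>y\<close> serves both \<open>f\<close> and \<open>g\<close>.\<close>

lemma weak_2_local_derivation_at_point:
  fixes \<Delta> :: "('w::topological_space \<Rightarrow>\<^sub>C 'a::cstar_algebra) \<Rightarrow> ('w \<Rightarrow>\<^sub>C 'a)"
  assumes inner: "\<forall>D :: ('w \<Rightarrow>\<^sub>C 'a) \<Rightarrow> ('w \<Rightarrow>\<^sub>C 'a). derivation D \<longrightarrow> inner_derivation D"
    and \<Delta>: "weak_2_local_derivation \<Delta>" and "\<phi> \<in> dual"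
  obtains y where "\<phi> (apply_bcontfun (\<Delta> f) t) = \<phi> (y * apply_bcontfun f t - apply_bcontfun f t * y)"
    and "\<phi> (apply_bcontfun (\<Delta> g) t) = \<phi> (y * apply_bcontfun g t - apply_bcontfun g t * y)"
proof -
  obtain D where D: "derivation D" "\<phi> (apply_bcontfun (\<Delta> f) t) = \<phi> (apply_bcontfun (D f) t)"
    "\<phi> (apply_bcontfun (\<Delta> g) t) = \<phi> (apply_bcontfun (D g) t)"
    using \<Delta>[unfolded weak_2_local_derivation_def, rule_format,
        OF dual_comp_eval[OF \<open>\<phi> \<in> dual\<close>, of t], of f g]
    by blast
  obtain x0 where "\<And>f. D f = x0 * f - f * x0"
    using inner D(1) unfolding inner_derivation_def by blast
  with D(2,3) show thesis
    by (intro that[of "apply_bcontfun x0 t"]) (simp_all add: times_bcontfun.rep_eq)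
qed

theorem theorem2p4:
  fixes \<Delta> :: "('w::t2_space \<Rightarrow>\<^sub>C 'a::cstar_algebra) \<Rightarrow> ('w \<Rightarrow>\<^sub>C 'a)"
  assumes "compact (UNIV :: 'w set)"
    and "\<forall>T :: 'a \<Rightarrow> 'a. weak_2_local_derivation T \<longrightarrow> derivation T"
    and "\<forall>D :: ('w \<Rightarrow>\<^sub>C 'a) \<Rightarrow> ('w \<Rightarrow>\<^sub>C 'a). derivation D \<longrightarrow> inner_derivation D"
    and "weak_2_local_derivation \<Delta>"
  shows "derivation \<Delta>"
proof -
  define T where "T t a = apply_bcontfun (\<Delta> (const_bcontfun a)) t" for t a
  note at_point = weak_2_local_derivation_at_point[OF assms(3,4)]
  have local: "apply_bcontfun (\<Delta> f) t = T t (apply_bcontfun f t)" for f t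
  proof (rule dual_eqI)
    fix \<phi> :: "'a \<Rightarrow> complex"
    assume "\<phi> \<in> dual"
    \<comment> \<open>The function \<open>f\<close> and the constant function with value
      \<open>f t\<close> agree at \<open>t\<close>, so the same commutator appears on both
      right-hand sides.\<close>
    then obtain y where
      "\<phi> (apply_bcontfun (\<Delta> f) t) = \<phi> (y * apply_bcontfun f t - apply_bcontfun f t * y)"
      "\<phi> (T t (apply_bcontfun f t)) = \<phi> (y * apply_bcontfun f t - apply_bcontfun f t * y)"
      by (rule at_point[of \<phi> f t "const_bcontfun (apply_bcontfun f t)",
            folded T_def, unfolded const_bcontfun.rep_eq])
    then show "\<phi> (apply_bcontfun (\<Delta> f) t) = \<phi> (T t (apply_bcontfun f t))" by simp
  qed
  have "weak_2_local_derivation (T t)" for t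
    unfolding weak_2_local_derivation_def
  proof (intro allI ballI)
    fix a b and \<phi> :: "'a \<Rightarrow> complex"
    assume "\<phi> \<in> dual"
    \<comment> \<open>For constant functions the commutator at \<open>t\<close> is that of
      \<open>y\<close> with \<open>a\<close> and \<open>b\<close>, so commutation with
      \<open>y\<close> is the required derivation.\<close>
    then obtain y where "\<phi> (T t a) = \<phi> (y * a - a * y)" "\<phi> (T t b) = \<phi> (y * b - b * y)"
      by (rule at_point[of \<phi> "const_bcontfun a" t "const_bcontfun b",
            folded T_def, unfolded const_bcontfun.rep_eq])
    with derivation_commutator[of y]
    show "\<exists>D. derivation D \<and> \<phi> (T t a) = \<phi> (D a) \<and> \<phi> (T t b) = \<phi> (D b)"
      by blast
  qed
  then have T: "derivation (T t)" for t
    using assms(2) by blast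
  show ?thesis
    unfolding derivation_def complex_linear_def
    using T[unfolded derivation_def complex_linear_def]
    by (auto intro!: bcontfun_eqI simp: local scaleC_bcontfun.rep_eq times_bcontfun.rep_eq)
qed

end
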